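(* Let $P$ be a pregroupoid with unique preinverses, and let $P[\mathsf{m}]$ be the set $P$ equipped with the restricted partial binary operation $\mathsf{m}:(x,y)\mapsto x\cdot y$, where $x\cdot y$ is defined if and only if $x^{-1}x=yy^{-1}$, in which case $x\cdot y=xy$. Then $P[\mathsf{m}]$ is a groupoid.
   Context: A magmoid is a non-empty set $P$ with a non-empty partial binary operation $(x,y)\mapsto xy$. A compound product such as $(xy)z$ is defined iff $xy$ is defined and the product of $xy$ with $z$ is defined (similarly for $x(yz)$). An asserted equation between products includes the assertion that both sides are defined. A semigroupoid is a magmoid $P$ such that for all $x,y,z\in P$: if $x(yz)$ is defined, or if $(xy)z$ is defined, or if both $xy$ and $yz$ are defined, then $x(yz)=(xy)z$ (both sides defined). A preinverse of $x\in P$ is some $x^{-1}\in P$ such that $(xx^{-1})x=x(x^{-1}x)=x$ and $(x^{-1}x)x^{-1}=x^{-1}(xx^{-1})=x^{-1}$ (all products defined). A prepoloid is a semigroupoid in which for every $x$ there are elements $\lambda_x,\rho_x$ with $\lambda_x x=x=x\rho_x$ (products defined). A pregroupoid is a prepoloid in which every element has a preinverse; it has unique preinverses if every $x$ has exactly one preinverse, denoted $x^{-1}$. (If $x^{-1}x=yy^{-1}$ then $xy$ is defined, so the restricted operation is well defined.) A two-sided unit in a magmoid $Q$ is some $e\in Q$ such that for every $y\in Q$: if $ey$ is defined then $ey=y$, and if $ye$ is defined then $ye=y$. A poloid is a semigroupoid $Q$ in which for every $x\in Q$ there are two-sided units $\ell_x,r_x$ with $\ell_x x=x=xr_x$ (products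 defined). A strong preinverse of $x$ is a preinverse $x^{-1}$ of $x$ such that $xx^{-1}$ and $x^{-1}x$ are two-sided units. A groupoid is a poloid in which every element has a strong preinverse. *)

theory Defs
  imports Main
begin

text \<open>
  A partial binary operation on a carrier set \<open>P\<close> is a function
  \<open>m :: 'a \<Rightarrow> 'a \<Rightarrow> 'a option\<close>, where \<open>m x y = None\<close> means that \<open>xy\<close> is undefined.
  The predicate \<open>magmoid\<close> demands that \<open>m\<close> is undefined outside \<open>P \<times> P\<close>.
\<close>

definition magmoid :: "'a set \<Rightarrow> ('a \<Rightarrow> 'a \<Rightarrow> 'a option) \<Rightarrow> bool" where
  "magmoid P m \<longleftrightarrow>
     P \<noteq> {} \<and>
     (\<forall>x y z. m x y = Some z \<longrightarrow> x \<in> P \<and> y \<in> P \<and> z \<in> P) \<and>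
     (\<exists>x y. m x y \<noteq> None)"

text \<open>The compound products \<open>(xy)z\<close> and \<open>x(yz)\<close>, respectively.\<close>

definition prod_left :: "('a \<Rightarrow> 'a \<Rightarrow> 'a option) \<Rightarrow> 'a \<Rightarrow> 'a \<Rightarrow> 'a \<Rightarrow> 'a option" where
  "prod_left m x y z = Option.bind (m x y) (\<lambda>u. m u z)"

definition prod_right :: "('a \<Rightarrow> 'a \<Rightarrow> 'a option) \<Rightarrow> 'a \<Rightarrow> 'a \<Rightarrow> 'a \<Rightarrow> 'a option" where
  "prod_right m x y z = Option.bind (m y z) (\<lambda>u. m x u)"

text \<open>An asserted equation between products includes that both sides are defined.\<close>

definition def_eq :: "'a option \<Rightarrow> 'a option \<Rightarrow> bool" where
  "def_eq s t \<longleftrightarrow> s \<noteq> None \<and> t \<noteq> None \<and> s = t"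

definition semigroupoid :: "'a set \<Rightarrow> ('a \<Rightarrow> 'a \<Rightarrow> 'a option) \<Rightarrow> bool" where
  "semigroupoid P m \<longleftrightarrow>
     magmoid P m \<and>
     (\<forall>x\<in>P. \<forall>y\<in>P. \<forall>z\<in>P.
        prod_right m x y z \<noteq> None \<or> prod_left m x y z \<noteq> None \<or> (m x y \<noteq> None \<and> m y z \<noteq> None)
        \<longrightarrow> def_eq (prod_right m x y z) (prod_left m x y z))"

definition preinverse :: "'a set \<Rightarrow> ('a \<Rightarrow> 'a \<Rightarrow> 'a option) \<Rightarrow> 'a \<Rightarrow> 'a \<Rightarrow> bool" where
  "preinverse P m x x' \<longleftrightarrow>
     x' \<in> P \<and>
     prod_left m x x' x = Some x \<and> prod_right m x x' x = Some x \<and>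
     prod_left m x' x x' = Some x' \<and> prod_right m x' x x' = Some x'"

definition prepoloid :: "'a set \<Rightarrow> ('a \<Rightarrow> 'a \<Rightarrow> 'a option) \<Rightarrow> bool" where
  "prepoloid P m \<longleftrightarrow>
     semigroupoid P m \<and>
     (\<forall>x\<in>P. \<exists>l\<in>P. \<exists>r\<in>P. m l x = Some x \<and> m x r = Some x)"

definition pregroupoid :: "'a set \<Rightarrow> ('a \<Rightarrow> 'a \<Rightarrow> 'a option) \<Rightarrow> bool" where
  "pregroupoid P m \<longleftrightarrow>
     prepoloid P m \<and> (\<forall>x\<in>P. \<exists>x'. preinverse P m x x')"

definition unique_preinverses :: "'a set \<Rightarrow> ('a \<Rightarrow> 'a \<Rightarrow> 'a option) \<Rightarrow> bool" where
  "unique_preinverses P m \<longleftrightarrow> (\<forall>x\<in>P. \<exists>!x'. preinverse P m x x')"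

definition the_preinverse :: "'a set \<Rightarrow> ('a \<Rightarrow> 'a \<Rightarrow> 'a option) \<Rightarrow> 'a \<Rightarrow> 'a" where
  "the_preinverse P m x = (THE x'. preinverse P m x x')"

definition two_sided_unit :: "'a set \<Rightarrow> ('a \<Rightarrow> 'a \<Rightarrow> 'a option) \<Rightarrow> 'a \<Rightarrow> bool" where
  "two_sided_unit P m e \<longleftrightarrow>
     e \<in> P \<and>
     (\<forall>y\<in>P. (m e y \<noteq> None \<longrightarrow> m e y = Some y) \<and> (m y e \<noteq> None \<longrightarrow> m y e = Some y))"

definition poloid :: "'a set \<Rightarrow> ('a \<Rightarrow> 'a \<Rightarrow> 'a option) \<Rightarrow> bool" where
  "poloid P m \<longleftrightarrow>
     semigroupoid P m \<and>
     (\<forall>x\<in>P. \<exists>l r. two_sided_unit P m l \<and> two_sided_unit P m r \<and> m l x = Some x \<and> m x r = Some x)"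

definition strong_preinverse :: "'a set \<Rightarrow> ('a \<Rightarrow> 'a \<Rightarrow> 'a option) \<Rightarrow> 'a \<Rightarrow> 'a \<Rightarrow> bool" where
  "strong_preinverse P m x x' \<longleftrightarrow>
     preinverse P m x x' \<and>
     (\<exists>e. m x x' = Some e \<and> two_sided_unit P m e) \<and>
     (\<exists>f. m x' x = Some f \<and> two_sided_unit P m f)"

definition groupoid :: "'a set \<Rightarrow> ('a \<Rightarrow> 'a \<Rightarrow> 'a option) \<Rightarrow> bool" where
  "groupoid P m \<longleftrightarrow> poloid P m \<and> (\<forall>x\<in>P. \<exists>x'. strong_preinverse P m x x')"

text \<open>
  If the condition of the conditional holds, then \<open>m x y\<close> is indeed defined; see the
  lemma \<open>restricted_op_defined_iff\<close> below.
\<close>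

definition restricted_op :: "'a set \<Rightarrow> ('a \<Rightarrow> 'a \<Rightarrow> 'a option) \<Rightarrow> 'a \<Rightarrow> 'a \<Rightarrow> 'a option" where
  "restricted_op P m x y =
     (if x \<in> P \<and> y \<in> P \<and> def_eq (m (the_preinverse P m x) x) (m y (the_preinverse P m y))
      then m x y else None)"

lemma preinverse_the_preinverse:
  assumes "unique_preinverses P m" "x \<in> P"
  shows "preinverse P m x (the_preinverse P m x)"
  using assms unfolding unique_preinverses_def the_preinverse_def by (metis theI')

lemma restricted_op_defined_iff:
  assumes "pregroupoid P m" "unique_preinverses P m" "x \<in> P" "y \<in> P"
  shows "restricted_op P m x y \<noteq> None \<longleftrightarrow>
           def_eq (m (the_preinverse P m x) x) (m y (the_preinverse P m y))"
proof
  assume "restricted_op P m x y \<noteq> None"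
  then show "def_eq (m (the_preinverse P m x) x) (m y (the_preinverse P m y))"
    unfolding restricted_op_def by (auto split: if_splits)
next
  assume eq: "def_eq (m (the_preinverse P m x) x) (m y (the_preinverse P m y))"
  then obtain e where e: "m (the_preinverse P m x) x = Some e" "m y (the_preinverse P m y) = Some e"
    unfolding def_eq_def by auto
  have sg: "semigroupoid P m"
    using assms(1) unfolding pregroupoid_def prepoloid_def by blast
  then have eP: "e \<in> P"
    using e unfolding semigroupoid_def magmoid_def by blast
  have xe: "m x e = Some x"
    using preinverse_the_preinverse[OF assms(2,3)] e
    unfolding preinverse_def prod_right_def by simp
  have ey: "m e y = Some y"
    using preinverse_the_preinverse[OF assms(2,4)] e
    unfolding preinverse_def prod_left_def by simp
  have "def_eq (prod_right m x e y) (prod_left m x e y)"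
    using sg assms(3,4) eP xe ey unfolding semigroupoid_def by blast
  then have "m x y \<noteq> None"
    unfolding def_eq_def prod_right_def using ey by simp
  then show "restricted_op P m x y \<noteq> None"
    unfolding restricted_op_def using assms eq by simp
qed

end

theory Submission
  imports Defs
begin

text \<open>
  Every idempotent is its own preinverse, so \<open>R x = xx\<inverse>\<close> and \<open>D x = x\<inverse>x\<close> are fixed by both
  \<open>R\<close> and \<open>D\<close>.  If \<open>D x = R y\<close>, then \<open>y\<inverse>x\<inverse>\<close> is defined and is a preinverse of \<open>xy\<close>, because the
  idempotents in the middle coincide; hence \<open>R (xy) = R x\<close> and \<open>D (xy) = D y\<close>.  So the restricted
  operation is composition with source \<open>D\<close>, target \<open>R\<close> and identities the idempotents.
\<close>

locale unique_pregroupoid =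
  fixes P :: "'a set" and m :: "'a \<Rightarrow> 'a \<Rightarrow> 'a option"
  assumes pregroupoid: "pregroupoid P m"
    and unique: "unique_preinverses P m"
begin

definition i :: "'a \<Rightarrow> 'a" where "i x = the_preinverse P m x"
text \<open>The default value of \<open>the\<close> never matters on \<open>P\<close>: the
  preinverse laws make both products defined there.\<close>

definition R :: "'a \<Rightarrow> 'a" where "R x = the (m x (i x))"
definition D :: "'a \<Rightarrow> 'a" where "D x = the (m (i x) x)"

lemma semigroupoid: "semigroupoid P m"
  using pregroupoid unfolding pregroupoid_def prepoloid_def by blast

lemma closed: "m x y = Some z \<Longrightarrow> x \<in> P \<and> y \<in> P \<and> z \<in> P"
  using semigroupoid unfolding semigroupoid_def magmoid_def by blast

lemma assoc:
  assumes "x \<in> P" "y \<in> P" "z \<in> P"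
    and "prod_right m x y z \<noteq> None \<or> prod_left m x y z \<noteq> None \<or> (m x y \<noteq> None \<and> m y z \<noteq> None)"
  shows "\<exists>u v w. m x y = Some u \<and> m y z = Some v \<and> m u z = Some w \<and> m x v = Some w"
proof -
  have "def_eq (prod_right m x y z) (prod_left m x y z)"
    using semigroupoid assms unfolding semigroupoid_def by blast
  then show ?thesis
    unfolding def_eq_def prod_right_def prod_left_def
    by (cases "m x y"; cases "m y z") auto
qed

lemma assoc_mid:
  assumes "m x y = Some u" "m y z = Some v"
  obtains w where "m u z = Some w" "m x v = Some w"
  using assoc[of x y z] closed[OF assms(1)] closed[OF assms(2)] assms by auto

lemma assoc_eq: "m x y = Some u \<Longrightarrow> m y z = Some v \<Longrightarrow> m u z = m x v"
  by (metis assoc_mid)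

lemma preinverse_i: "x \<in> P \<Longrightarrow> preinverse P m x (i x)"
  using preinverse_the_preinverse[OF unique] by (simp add: i_def)

lemma i_eqI: "x \<in> P \<Longrightarrow> preinverse P m x y \<Longrightarrow> i x = y"
  using unique preinverse_i unfolding unique_preinverses_def by blast

lemma i_closed: "x \<in> P \<Longrightarrow> i x \<in> P"
  using preinverse_i unfolding preinverse_def by blast

text \<open>The preinverse equations are symmetric in the two elements, so \<open>x\<close> is a
  candidate for the unique preinverse of \<open>i x\<close>.\<close>

lemma i_i: "x \<in> P \<Longrightarrow> i (i x) = x"
  by (rule i_eqI[OF i_closed]) (use preinverse_i[of x] in \<open>auto simp: preinverse_def\<close>)

lemma
  assumes "x \<in> P"
  shows m_i_right: "m x (i x) = Some (R x)" and m_i_left: "m (i x) x = Some (D x)"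
    and m_R: "m (R x) x = Some x" and m_D: "m x (D x) = Some x"
    and m_D_i: "m (D x) (i x) = Some (i x)" and m_i_R: "m (i x) (R x) = Some (i x)"
  using preinverse_i[OF assms]
  by (cases "m x (i x)"; cases "m (i x) x";
      auto simp: preinverse_def prod_left_def prod_right_def R_def D_def)+

lemma R_i: "x \<in> P \<Longrightarrow> R (i x) = D x"
  by (simp add: R_def D_def i_i)

lemma D_i: "x \<in> P \<Longrightarrow> D (i x) = R x"
  by (simp add: R_def D_def i_i)

lemma R_closed: "x \<in> P \<Longrightarrow> R x \<in> P"
  using closed[OF m_R] by blast

lemma D_closed: "x \<in> P \<Longrightarrow> D x \<in> P"
  using closed[OF m_D] by blast

lemma i_idem: "m e e = Some e \<Longrightarrow> i e = e"
  by (rule i_eqI) (auto simp: preinverse_def prod_left_def prod_right_def dest: closed)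

lemma R_idem: "m e e = Some e \<Longrightarrow> R e = e"
  by (simp add: R_def i_idem)

lemma D_idem: "m e e = Some e \<Longrightarrow> D e = e"
  by (simp add: D_def i_idem)

lemma idem_R: "x \<in> P \<Longrightarrow> m (R x) (R x) = Some (R x)"
  using assoc_eq[OF m_i_right m_i_R] by (simp add: m_i_right)

lemma idem_D: "x \<in> P \<Longrightarrow> m (D x) (D x) = Some (D x)"
  using idem_R[OF i_closed] by (simp add: R_i)

text \<open>With \<open>e = D x = R y\<close>, both \<open>xe = x\<close> and \<open>ey = y\<close>
  are defined, so associativity makes \<open>(xe)y = xy\<close> defined.\<close>

lemma composable_defined:
  assumes "x \<in> P" "y \<in> P" "D x = R y"
  obtains z where "m x y = Some z"
  using assoc_mid[OF m_D[OF assms(1)], of y y] m_R[OF assms(2)] assms(3) by auto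

text \<open>Multiplying \<open>xy\<close> on the right by \<open>y\<inverse>x\<inverse>\<close> collapses from the middle:
  \<open>(xy)y\<inverse> = x(D x) = x\<close>.\<close>

lemma m_prod_inverse:
  assumes "x \<in> P" "y \<in> P" "D x = R y" "m x y = Some z" "m (i y) (i x) = Some w"
  shows "m z w = Some (R x)"
proof -
  have "m z (i y) = Some x"
    using assoc_eq[OF assms(4) m_i_right[OF assms(2)]] m_D[OF assms(1)] assms(3) by simp
  from assoc_eq[OF this assms(5)] show ?thesis
    using m_i_right[OF assms(1)] by simp
qed

text \<open>This needs no matching condition, since \<open>R x\<close> already fixes the left
  factor. With its mirror image it supplies the remaining laws once \<open>zw\<close> and
  \<open>wz\<close> are known in \<open>R_mult\<close>.\<close>

lemma m_R_left: "m x y = Some z \<Longrightarrow> m (R x) z = Some z"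
  using assoc_eq[OF m_R] closed by metis

lemma m_D_right: "m x y = Some z \<Longrightarrow> m z (D y) = Some z"
  using assoc_eq[OF _ m_D] closed by metis

lemma
  assumes "x \<in> P" "y \<in> P" "D x = R y" "m x y = Some z"
  shows R_mult: "R z = R x" and D_mult: "D z = D y"
proof -
  have iP: "i x \<in> P" "i y \<in> P" and eq: "D (i y) = R (i x)"
    using assms i_closed by (simp_all add: R_i D_i)
  then obtain w where w: "m (i y) (i x) = Some w"
    using composable_defined by blast
  have zw: "m z w = Some (R x)"
    using m_prod_inverse[OF assms w] .
  \<comment> \<open>The same collapse, applied to the pair \<open>i y\<close>, \<open>i x\<close>,
    whose preinverses are \<open>y\<close> and \<open>x\<close>.\<close>
  have wz: "m w z = Some (D y)"
    using m_prod_inverse[OF iP(2,1) eq w] assms by (simp add: i_i R_i)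
  have "preinverse P m z w"
    using zw wz m_R_left[OF assms(4)] m_D_right[OF assms(4)] m_R_left[OF w] m_D_right[OF w]
      closed[OF w] assms
    by (simp add: preinverse_def prod_left_def prod_right_def R_i D_i)
  then have "i z = w"
    using i_eqI closed[OF assms(4)] by blast
  then show "R z = R x" "D z = D y"
    using zw wz by (simp_all add: R_def D_def)
qed

text \<open>On \<open>P\<close> the two products compared by \<open>restricted_op\<close> always
  exist, so its test becomes the plain equation \<open>D x = R y\<close>.\<close>

abbreviation "n \<equiv> restricted_op P m"

lemma n_eq: "n x y = (if x \<in> P \<and> y \<in> P \<and> D x = R y then m x y else None)"
  using m_i_left m_i_right by (auto simp: restricted_op_def def_eq_def i_def)

lemma n_eq_Some_iff: "n x y = Some z \<longleftrightarrow> x \<in> P \<and> y \<in> P \<and> D x = R y \<and> m x y = Some z"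
  by (auto simp: n_eq)

lemma n_i_right: "x \<in> P \<Longrightarrow> n x (i x) = Some (R x)"
  by (simp add: n_eq i_closed R_i m_i_right)

lemma n_i_left: "x \<in> P \<Longrightarrow> n (i x) x = Some (D x)"
  by (simp add: n_eq i_closed D_i m_i_left)

lemma n_R: "x \<in> P \<Longrightarrow> n (R x) x = Some x"
  by (simp add: n_eq R_closed m_R D_idem[OF idem_R])

lemma n_D: "x \<in> P \<Longrightarrow> n x (D x) = Some x"
  by (simp add: n_eq D_closed m_D R_idem[OF idem_D])

text \<open>As \<open>D\<close> and \<open>R\<close> fix \<open>e\<close>, a defined restricted
  product with \<open>y\<close> forces \<open>e = R y\<close> or \<open>e = D y\<close>, depending
  on the side. Under \<open>m\<close> itself an idempotent need not be a unit.\<close>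

lemma unit_if_idem:
  assumes "m e e = Some e"
  shows "two_sided_unit P n e"
proof -
  have "n e y = Some y" if "n e y \<noteq> None" "y \<in> P" for y
  proof -
    have "e = R y"
      using that D_idem[OF assms] by (simp add: n_eq split: if_splits)
    then show ?thesis
      using n_R[OF that(2)] by simp
  qed
  moreover have "n y e = Some y" if "n y e \<noteq> None" "y \<in> P" for y
  proof -
    have "e = D y"
      using that R_idem[OF assms] by (simp add: n_eq split: if_splits)
    then show ?thesis
      using n_D[OF that(2)] by simp
  qed
  ultimately show ?thesis
    using closed[OF assms] unfolding two_sided_unit_def by blast
qed

lemma magmoid_n: "magmoid P n"
proof -
  obtain x where "x \<in> P"
    using semigroupoid unfolding semigroupoid_def magmoid_def by blast
  then have "n x (i x) \<noteq> None"
    by (simp add: n_i_right)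
  then show ?thesis
    using \<open>x \<in> P\<close> closed unfolding magmoid_def n_eq_Some_iff by blast
qed

lemma n_assoc:
  assumes "x \<in> P" "y \<in> P" "z \<in> P" "D x = R y" "D y = R z"
  shows "def_eq (prod_right n x y z) (prod_left n x y z)"
proof -
  obtain u where u: "m x y = Some u"
    using composable_defined assms by blast
  obtain v where v: "m y z = Some v"
    using composable_defined assms by blast
  obtain w where "m u z = Some w" "m x v = Some w"
    using assoc_mid[OF u v] .
  then show ?thesis
    \<comment> \<open>\<open>D u = D y\<close> and \<open>R v = R y\<close> carry the matching
      conditions over to the outer products.\<close>
    using u v assms closed[OF u] closed[OF v] D_mult[OF assms(1,2,4) u] R_mult[OF assms(2,3,5) v]
    by (simp add: def_eq_def prod_right_def prod_left_def n_eq)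
qed

lemma semigroupoid_n: "semigroupoid P n"
  unfolding semigroupoid_def
proof (intro conjI ballI impI)
  fix x y z
  assume P: "x \<in> P" "y \<in> P" "z \<in> P"
    and "prod_right n x y z \<noteq> None \<or> prod_left n x y z \<noteq> None \<or> (n x y \<noteq> None \<and> n y z \<noteq> None)"
  then consider v w where "n y z = Some v" "n x v = Some w"
    | u w where "n x y = Some u" "n u z = Some w"
    | u v where "n x y = Some u" "n y z = Some v"
    by (auto simp: prod_right_def prod_left_def bind_eq_Some_conv)
  \<comment> \<open>A condition on a compound factor reduces to one on \<open>y\<close>:
    \<open>R v = R y\<close> in the first case, \<open>D u = D y\<close> in the second.\<close>
  then have "D x = R y \<and> D y = R z"
    unfolding n_eq_Some_iff by cases (metis R_mult, metis D_mult, blast)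
  then show "def_eq (prod_right n x y z) (prod_left n x y z)"
    using n_assoc P by blast
qed (rule magmoid_n)

lemma preinverse_n: "x \<in> P \<Longrightarrow> preinverse P n x (i x)"
  using n_R[of "i x"] n_D[of "i x"]
  by (simp add: preinverse_def prod_left_def prod_right_def i_closed n_i_left n_i_right n_R n_D
      R_i D_i)

text \<open>The idempotents \<open>R x\<close> and \<open>D x\<close> serve twice: as the left and
  right units of \<open>x\<close>, and as its products with \<open>i x\<close>.\<close>

lemma groupoid_n: "groupoid P n"
  unfolding groupoid_def poloid_def strong_preinverse_def
  by (meson semigroupoid_n preinverse_n n_R n_D n_i_left n_i_right
      unit_if_idem idem_R idem_D)

end

theorem theorem8p3:
  fixes P :: "'a set" and m :: "'a \<Rightarrow> 'a \<Rightarrow> 'a option"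
  assumes "pregroupoid P m"
    and "unique_preinverses P m"
  shows "groupoid P (restricted_op P m)"
  using unique_pregroupoid.groupoid_n[OF unique_pregroupoid.intro[OF assms]] .

end
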